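(* Let $X,Y$ be finite sets and let $\alpha$ be a partitioned binary relation on $(X,Y)$. Define: (i) $\gamma_\alpha$: the pure PBR on $(X,Y)$ consisting of all edges of $\alpha$ which contain one element of $\mathrm{Dom}(\alpha)=X$ and one element of $\mathrm{Codom}(\alpha)=Y$; (ii) $\beta_\alpha$: the left polarized idempotent in $\mathfrak{PB}(Y,Y)$ such that, for all $a,b\in Y=\mathrm{Codom}(\alpha)$, $(a^{(c)},b^{(c)})\in\beta_\alpha$ if and only if $(a,b)\in\alpha$; (iii) $\delta_\alpha$: the right polarized idempotent in $\mathfrak{PB}(X,X)$ such that, for all $a,b\in X=\mathrm{Dom}(\alpha)$, $(a^{(d)},b^{(d)})\in\delta_\alpha$ if and only if $(a,b)\in\alpha$. Then $\alpha=\beta_\alpha\circ\gamma_\alpha\circ\delta_\alpha$, and this is the unique factorization of $\alpha$ as a product of a left polarized idempotent in $\mathfrak{PB}(Y,Y)$, a pure PBR on $(X,Y)$ and a right polarized idempotent in $\mathfrak{PB}(X,X)$ (in this order).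
   Context: For finite sets $X,Y$, a partitioned binary relation (PBR) on $(X,Y)$ is a binary relation $\alpha\subseteq (X\coprod Y)^2$ on the disjoint union $X\coprod Y$; $X=\mathrm{Dom}(\alpha)$ is its domain and $Y=\mathrm{Codom}(\alpha)$ its codomain; pairs $(a,b)\in\alpha$ are called edges. If $X$ and $Y$ overlap, $a^{(d)}$ and $a^{(c)}$ denote $a$ seen in the domain, respectively codomain. $\mathfrak{PB}(X,Y)$ is the set of all PBRs on $(X,Y)$. Composition: let $\alpha$ be a PBR on $(X,Y)$ and $\beta$ a PBR on $(Y,Z)$; regard edges of both as pairs of elements of $X\coprod Y\coprod Z$. An $(\alpha,\beta)$-connected sequence is a finite nonempty sequence $(a_1,b_1),\dots,(a_m,b_m)$ of edges, each taken from $\alpha$ or from $\beta$, such that no two successive edges are taken from the same PBR and $b_i=a_{i+1}$ for $i=1,\dots,m-1$; it connects $a_1$ to $b_m$. $\beta\circ\alpha$ is the PBR on $(X,Z)$ such that, for $a,b\in X\coprod Z$, $(a,b)\in\beta\circ\alpha$ iff some $(\alpha,\beta)$-connected sequence connects $a$ to $b$. This composition is associative. $\varepsilon_X$ is the PBR on $(X,X)$ consisting exactly of the edges $(x^{(d)},x^{(c)})$ and $(x^{(c)},x^{(d)})$, $x\in X$. A PBR is pure if each of its edges consists of one element of the domain and one element of the codomain (in either order). An element $\alpha\in\mathfrak{PB}(X,X)$ is a left polarized idempotent if it contains all edges of $\varepsilon_X$ and any other edge of $\alpha$ has the form $(a,b)$ with $a,b\in\mathrm{Codom}(\alpha)$;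 it is a right polarized idempotent if it contains all edges of $\varepsilon_X$ and any other edge has the form $(a,b)$ with $a,b\in\mathrm{Dom}(\alpha)$. *)

theory Defs
  imports Main
begin

text \<open>
  A PBR on \<open>(X, Y)\<close> is a relation on the disjoint union \<open>X <+> Y\<close>: \<open>Inl x\<close> is \<open>x\<close> seen in the
  domain, \<open>Inr y\<close> is \<open>y\<close> seen in the codomain. In particular \<open>X\<close> and \<open>Y\<close> may overlap or coincide.
\<close>

type_synonym ('a, 'b) pbr = "(('a + 'b) \<times> ('a + 'b)) set"

definition PB :: "'a set \<Rightarrow> 'b set \<Rightarrow> ('a, 'b) pbr set" where
  "PB X Y = {\<alpha>. \<alpha> \<subseteq> (X <+> Y) \<times> (X <+> Y)}"

text \<open>
  The same pair of elements of the middle set can be an edge of both relations, so each entry of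
  a connected sequence records the relation it is taken from.
\<close>

datatype origin = First | Second

fun edges_from :: "'v rel \<Rightarrow> 'v rel \<Rightarrow> origin \<Rightarrow> 'v rel" where
  "edges_from A B First = A"
| "edges_from A B Second = B"

definition connected_seq :: "'v rel \<Rightarrow> 'v rel \<Rightarrow> (origin \<times> 'v \<times> 'v) list \<Rightarrow> bool" where
  "connected_seq A B es \<longleftrightarrow>
     es \<noteq> [] \<and>
     (\<forall>(k, e) \<in> set es. e \<in> edges_from A B k) \<and>
     successively (\<lambda>(k, (a, b)) (l, (c, d)). k \<noteq> l \<and> b = c) es"

definition connects :: "(origin \<times> 'v \<times> 'v) list \<Rightarrow> 'v \<Rightarrow> 'v \<Rightarrow> bool" where
  "connects es a b \<longleftrightarrow> a = fst (snd (hd es)) \<and> b = snd (snd (last es))"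

text \<open>
  For \<open>\<alpha>\<close> on \<open>(X, Y)\<close> and \<open>\<beta>\<close> on \<open>(Y, Z)\<close>, all edges are moved into the triple disjoint union
  \<open>X <+> (Y <+> Z)\<close>: \<open>map_sum id Inl\<close>, \<open>Inr\<close> and \<open>map_sum id Inr\<close> are the inclusions of
  \<open>X <+> Y\<close>, \<open>Y <+> Z\<close> and \<open>X <+> Z\<close>. No carriers are needed as arguments, see \<open>pbr_comp_in_PB\<close>.
\<close>

definition pbr_comp :: "('b, 'c) pbr \<Rightarrow> ('a, 'b) pbr \<Rightarrow> ('a, 'c) pbr"  (infixr \<open>\<circ>\<^sub>P\<close> 75) where
  "\<beta> \<circ>\<^sub>P \<alpha> =
     {(a, b). \<exists>es.
        connected_seq (map_prod (map_sum id Inl) (map_sum id Inl) ` \<alpha>) (map_prod Inr Inr ` \<beta>) es \<and>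
        connects es (map_sum id Inr a) (map_sum id Inr b)}"

definition pbr_id :: "'a set \<Rightarrow> ('a, 'a) pbr" where
  "pbr_id X = (\<lambda>x. (Inl x, Inr x)) ` X \<union> (\<lambda>x. (Inr x, Inl x)) ` X"

definition pure_pbr :: "'a set \<Rightarrow> 'b set \<Rightarrow> ('a, 'b) pbr \<Rightarrow> bool" where
  "pure_pbr X Y \<gamma> \<longleftrightarrow>
     \<gamma> \<in> PB X Y \<and>
     (\<forall>(a, b) \<in> \<gamma>. (a \<in> Inl ` X \<and> b \<in> Inr ` Y) \<or> (a \<in> Inr ` Y \<and> b \<in> Inl ` X))"

definition left_polarized :: "'a set \<Rightarrow> ('a, 'a) pbr \<Rightarrow> bool" where
  "left_polarized X \<alpha> \<longleftrightarrow>
     \<alpha> \<in> PB X X \<and> pbr_id X \<subseteq> \<alpha> \<and> (\<forall>(a, b) \<in> \<alpha> - pbr_id X. a \<in> Inr ` X \<and> b \<in> Inr ` X)"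

definition right_polarized :: "'a set \<Rightarrow> ('a, 'a) pbr \<Rightarrow> bool" where
  "right_polarized X \<alpha> \<longleftrightarrow>
     \<alpha> \<in> PB X X \<and> pbr_id X \<subseteq> \<alpha> \<and> (\<forall>(a, b) \<in> \<alpha> - pbr_id X. a \<in> Inl ` X \<and> b \<in> Inl ` X)"

definition pure_part :: "'a set \<Rightarrow> 'b set \<Rightarrow> ('a, 'b) pbr \<Rightarrow> ('a, 'b) pbr" where
  "pure_part X Y \<alpha> =
     {(a, b) \<in> \<alpha>. (a \<in> Inl ` X \<and> b \<in> Inr ` Y) \<or> (a \<in> Inr ` Y \<and> b \<in> Inl ` X)}"

definition left_part :: "'b set \<Rightarrow> ('a, 'b) pbr \<Rightarrow> ('b, 'b) pbr" where
  "left_part Y \<alpha> = pbr_id Y \<union> {(Inr a, Inr b) | a b. a \<in> Y \<and> b \<in> Y \<and> (Inr a, Inr b) \<in> \<alpha>}"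

definition right_part :: "'a set \<Rightarrow> ('a, 'b) pbr \<Rightarrow> ('a, 'a) pbr" where
  "right_part X \<alpha> = pbr_id X \<union> {(Inl a, Inl b) | a b. a \<in> X \<and> b \<in> X \<and> (Inl a, Inl b) \<in> \<alpha>}"

lemma left_part_iff:
  "\<beta> = left_part Y \<alpha> \<longleftrightarrow>
     left_polarized Y \<beta> \<and> (\<forall>a\<in>Y. \<forall>b\<in>Y. (Inr a, Inr b) \<in> \<beta> \<longleftrightarrow> (Inr a, Inr b) \<in> \<alpha>)"
  (is "_ \<longleftrightarrow> ?R \<beta>")
proof -
  have part: "?R (left_part Y \<alpha>)"
    by (auto simp: left_part_def left_polarized_def PB_def pbr_id_def)
  have rep: "\<eta> = pbr_id Y \<union> {(Inr a, Inr b) | a b. a \<in> Y \<and> b \<in> Y \<and> (Inr a, Inr b) \<in> \<eta>}"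
    if "left_polarized Y \<eta>" for \<eta>
  proof (rule set_eqI, rule iffI)
    fix e
    assume "e \<in> \<eta>"
    then show "e \<in> pbr_id Y \<union> {(Inr a, Inr b) | a b. a \<in> Y \<and> b \<in> Y \<and> (Inr a, Inr b) \<in> \<eta>}"
      using that by (cases "e \<in> pbr_id Y") (auto simp: left_polarized_def dest!: bspec[where x = e])
  qed (use that in \<open>auto simp: left_polarized_def\<close>)
  have "\<beta> = left_part Y \<alpha>" if R: "?R \<beta>"
  proof -
    have "{(Inr a, Inr b) | a b. a \<in> Y \<and> b \<in> Y \<and> (Inr a, Inr b) \<in> \<beta>} =
          {(Inr a, Inr b) | a b. a \<in> Y \<and> b \<in> Y \<and> (Inr a, Inr b) \<in> \<alpha>}"
      using R by auto
    with rep[OF conjunct1[OF R]] show ?thesis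
      unfolding left_part_def by (rule back_subst[where P = "\<lambda>S. \<beta> = pbr_id Y \<union> S"])
  qed
  with part show ?thesis
    by blast
qed

lemma right_part_iff:
  "\<delta> = right_part X \<alpha> \<longleftrightarrow>
     right_polarized X \<delta> \<and> (\<forall>a\<in>X. \<forall>b\<in>X. (Inl a, Inl b) \<in> \<delta> \<longleftrightarrow> (Inl a, Inl b) \<in> \<alpha>)"
  (is "_ \<longleftrightarrow> ?R \<delta>")
proof -
  have part: "?R (right_part X \<alpha>)"
    by (auto simp: right_part_def right_polarized_def PB_def pbr_id_def)
  have rep: "\<eta> = pbr_id X \<union> {(Inl a, Inl b) | a b. a \<in> X \<and> b \<in> X \<and> (Inl a, Inl b) \<in> \<eta>}"
    if "right_polarized X \<eta>" for \<eta>
  proof (rule set_eqI, rule iffI)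
    fix e
    assume "e \<in> \<eta>"
    then show "e \<in> pbr_id X \<union> {(Inl a, Inl b) | a b. a \<in> X \<and> b \<in> X \<and> (Inl a, Inl b) \<in> \<eta>}"
      using that by (cases "e \<in> pbr_id X") (auto simp: right_polarized_def dest!: bspec[where x = e])
  qed (use that in \<open>auto simp: right_polarized_def\<close>)
  have "\<delta> = right_part X \<alpha>" if R: "?R \<delta>"
  proof -
    have "{(Inl a, Inl b) | a b. a \<in> X \<and> b \<in> X \<and> (Inl a, Inl b) \<in> \<delta>} =
          {(Inl a, Inl b) | a b. a \<in> X \<and> b \<in> X \<and> (Inl a, Inl b) \<in> \<alpha>}"
      using R by auto
    with rep[OF conjunct1[OF R]] show ?thesis
      unfolding right_part_def by (rule back_subst[where P = "\<lambda>S. \<delta> = pbr_id X \<union> S"])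
  qed
  with part show ?thesis
    by blast
qed

lemma pbr_comp_in_PB:
  assumes "\<alpha> \<in> PB X Y" and "\<beta> \<in> PB Y Z"
  shows "\<beta> \<circ>\<^sub>P \<alpha> \<in> PB X Z"
proof -
  let ?A = "map_prod (map_sum id Inl) (map_sum id Inl) ` \<alpha>"
  let ?B = "map_prod Inr Inr ` \<beta>"
  have AB: "edges_from ?A ?B k \<subseteq> (X <+> (Y <+> Z)) \<times> (X <+> (Y <+> Z))" for k
    using assms by (cases k) (fastforce simp: PB_def)+
  have pull: "u \<in> X <+> Z" if "map_sum id Inr u \<in> X <+> (Y <+> Z)" for u
    using that by (cases u) auto
  have "a \<in> X <+> Z \<and> b \<in> X <+> Z" if "(a, b) \<in> \<beta> \<circ>\<^sub>P \<alpha>" for a b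
  proof -
    from that obtain es where es: "connected_seq ?A ?B es"
      and ab: "connects es (map_sum id Inr a) (map_sum id Inr b)"
      unfolding pbr_comp_def by blast
    then have "snd (hd es) \<in> edges_from ?A ?B (fst (hd es))"
      "snd (last es) \<in> edges_from ?A ?B (fst (last es))"
      unfolding connected_seq_def by (auto simp: case_prod_beta)
    with AB have "snd (hd es) \<in> (X <+> (Y <+> Z)) \<times> (X <+> (Y <+> Z))"
      "snd (last es) \<in> (X <+> (Y <+> Z)) \<times> (X <+> (Y <+> Z))"
      by blast+
    with ab show ?thesis
      by (auto simp: connects_def mem_Times_iff intro!: pull)
  qed
  then show ?thesis
    unfolding PB_def by auto
qed

end

theory Submission
  imports Defs
begin

text \<open>
  A connected sequence of length at least three contains an edge whose two endpoints both lie in the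
  middle set: its second edge is preceded and followed by edges of the other relation. In the
  product of a left polarized idempotent \<open>\<beta>\<close>, a pure \<open>\<gamma>\<close> and a right polarized idempotent \<open>\<delta>\<close> there is
  no such edge at either composition: \<open>\<delta>\<close> has none inside its codomain and \<open>\<gamma>\<close> none inside its
  domain; \<open>\<gamma> \<circ>\<^sub>P \<delta>\<close> has none inside its codomain, where it agrees with \<open>\<gamma>\<close>, and \<open>\<beta>\<close> has none inside its
  domain. So only sequences of length one and two count
  (\<open>pbr_comp_no_return\<close>), and since the edges of \<open>\<beta>\<close> and of \<open>\<delta>\<close> between domain and codomain
  are exactly those of an identity, the product is read off edge by edge: inside \<open>Y\<close> it is \<open>\<beta>\<close>, inside \<open>X\<close> it is \<open>\<delta>\<close>, and between
  \<open>X\<close> and \<open>Y\<close> it is \<open>\<gamma>\<close> (\<open>polarized_product_edges\<close>). Each factor is determined by its edges of the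
  respective kind, which gives existence and uniqueness at once.
\<close>

text \<open>
  The two emptiness assumptions forbid any three consecutive edges, hence any longer sequence.
\<close>

lemma ex_connected_seq_iff_short:
  assumes "A O B O A = {}" and "B O A O B = {}"
  shows "(\<exists>es. connected_seq A B es \<and> connects es u v) \<longleftrightarrow> (u, v) \<in> A \<union> B \<union> A O B \<union> B O A"
proof
  assume "\<exists>es. connected_seq A B es \<and> connects es u v"
  then obtain es where es: "connected_seq A B es" "connects es u v"
    by blast
  then obtain k1 a1 b1 ds where ds: "es = (k1, a1, b1) # ds"
    unfolding connected_seq_def by (metis list.exhaust prod_cases3)
  show "(u, v) \<in> A \<union> B \<union> A O B \<union> B O A"
  proof (cases ds)
    case Nil
    with es ds show ?thesis
      by (cases k1) (auto simp: connected_seq_def connects_def)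
  next
    case (Cons d fs)
    obtain k2 a2 b2 where d: "d = (k2, a2, b2)"
      by (metis prod_cases3)
    show ?thesis
    proof (cases fs)
      case Nil
      with es ds Cons d show ?thesis
        by (cases k1; cases k2) (auto simp: connected_seq_def connects_def)
    next
      case inner: (Cons f gs)
      obtain k3 a3 b3 where f: "f = (k3, a3, b3)"
        by (metis prod_cases3)
      have "(a1, b3) \<in> A O B O A \<union> B O A O B"
        using es(1) ds Cons d inner f
        by (cases k1; cases k2; cases k3) (auto simp: connected_seq_def)
      with assms show ?thesis
        by blast
    qed
  qed
next
  have one: "connected_seq A B [(k, u, v)] \<and> connects [(k, u, v)] u v"
    if "(u, v) \<in> edges_from A B k" for k
    using that by (simp add: connected_seq_def connects_def)
  have two: "connected_seq A B [(k, u, w), (l, w, v)] \<and> connects [(k, u, w), (l, w, v)] u v"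
    if "(u, w) \<in> edges_from A B k" "(w, v) \<in> edges_from A B l" "k \<noteq> l" for k l w
    using that by (simp add: connected_seq_def connects_def)
  assume "(u, v) \<in> A \<union> B \<union> A O B \<union> B O A"
  then consider "(u, v) \<in> edges_from A B First" | "(u, v) \<in> edges_from A B Second"
    | w where "(u, w) \<in> edges_from A B First" "(w, v) \<in> edges_from A B Second"
    | w where "(u, w) \<in> edges_from A B Second" "(w, v) \<in> edges_from A B First"
    by auto
  then show "\<exists>es. connected_seq A B es \<and> connects es u v"
    by cases (use one two in blast)+
qed

text \<open>
  A path that enters the middle set must leave it at the other side, because neither
  relation can turn it back.
\<close>

lemma pbr_comp_no_return:
  fixes \<alpha> :: "('a, 'b) pbr" and \<beta> :: "('b, 'c) pbr"
  assumes \<alpha>: "\<And>m n. (Inr m, Inr n) \<notin> \<alpha>" and \<beta>: "\<And>m n. (Inl m, Inl n) \<notin> \<beta>"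
  shows "(Inl a, Inl a') \<in> \<beta> \<circ>\<^sub>P \<alpha> \<longleftrightarrow> (Inl a, Inl a') \<in> \<alpha>"
    and "(Inr c, Inr c') \<in> \<beta> \<circ>\<^sub>P \<alpha> \<longleftrightarrow> (Inr c, Inr c') \<in> \<beta>"
    and "(Inl a, Inr c) \<in> \<beta> \<circ>\<^sub>P \<alpha> \<longleftrightarrow> (\<exists>m. (Inl a, Inr m) \<in> \<alpha> \<and> (Inl m, Inr c) \<in> \<beta>)"
    and "(Inr c, Inl a) \<in> \<beta> \<circ>\<^sub>P \<alpha> \<longleftrightarrow> (\<exists>m. (Inr c, Inl m) \<in> \<beta> \<and> (Inr m, Inl a) \<in> \<alpha>)"
proof -
  let ?A = "map_prod (map_sum id Inl) (map_sum id Inl) ` \<alpha> :: ('a + 'b + 'c) rel"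
  let ?B = "map_prod Inr Inr ` \<beta> :: ('a + 'b + 'c) rel"
  have A_iff: "(u, v) \<in> ?A \<longleftrightarrow>
      (\<exists>p q. u = map_sum id Inl p \<and> v = map_sum id Inl q \<and> (p, q) \<in> \<alpha>)" for u v
    by force
  have B_iff: "(u, v) \<in> ?B \<longleftrightarrow> (\<exists>p q. u = Inr p \<and> v = Inr q \<and> (p, q) \<in> \<beta>)" for u v
    by force
  have sum_iff: "map_sum id Inl p = Inl x \<longleftrightarrow> p = Inl x"
    "Inl x = map_sum id Inl p \<longleftrightarrow> p = Inl x"
    "map_sum id Inl p = Inr z \<longleftrightarrow> (\<exists>m. p = Inr m \<and> z = Inl m)"
    "Inr z = map_sum id Inl p \<longleftrightarrow> (\<exists>m. p = Inr m \<and> z = Inl m)"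
    for p :: "'a + 'b" and x and z :: "'b + 'c"
    by (cases p; auto)+
  have "(u, v) \<notin> ?A O ?B O ?A" for u v
    unfolding relcomp_unfold mem_Collect_eq case_prod_conv A_iff B_iff
    using \<beta> by (auto simp: sum_iff)
  then have "?A O ?B O ?A = {}"
    by (metis equals0I surj_pair)
  moreover have "(u, v) \<notin> ?B O ?A O ?B" for u v
    unfolding relcomp_unfold mem_Collect_eq case_prod_conv A_iff B_iff
    using \<alpha> by (auto simp: sum_iff)
  then have "?B O ?A O ?B = {}"
    by (metis equals0I surj_pair)
  ultimately have comp: "(u, v) \<in> \<beta> \<circ>\<^sub>P \<alpha> \<longleftrightarrow>
      (map_sum id Inr u, map_sum id Inr v) \<in> ?A \<union> ?B \<union> ?A O ?B \<union> ?B O ?A" for u v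
    unfolding pbr_comp_def by (simp only: mem_Collect_eq case_prod_conv ex_connected_seq_iff_short)
  show "(Inl a, Inl a') \<in> \<beta> \<circ>\<^sub>P \<alpha> \<longleftrightarrow> (Inl a, Inl a') \<in> \<alpha>"
    "(Inr c, Inr c') \<in> \<beta> \<circ>\<^sub>P \<alpha> \<longleftrightarrow> (Inr c, Inr c') \<in> \<beta>"
    "(Inl a, Inr c) \<in> \<beta> \<circ>\<^sub>P \<alpha> \<longleftrightarrow> (\<exists>m. (Inl a, Inr m) \<in> \<alpha> \<and> (Inl m, Inr c) \<in> \<beta>)"
    "(Inr c, Inl a) \<in> \<beta> \<circ>\<^sub>P \<alpha> \<longleftrightarrow> (\<exists>m. (Inr c, Inl m) \<in> \<beta> \<and> (Inr m, Inl a) \<in> \<alpha>)"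
    unfolding comp Un_iff relcomp_unfold mem_Collect_eq case_prod_conv A_iff B_iff
    by (auto simp: sum_iff)
qed

lemma left_polarized_edges:
  assumes "left_polarized Y \<beta>"
  shows "(Inl a, Inl b) \<notin> \<beta>"
    and "(Inl a, Inr b) \<in> \<beta> \<longleftrightarrow> a = b \<and> a \<in> Y"
    and "(Inr a, Inl b) \<in> \<beta> \<longleftrightarrow> a = b \<and> a \<in> Y"
proof -
  have eq: "\<beta> = left_part Y \<beta>"
    using assms by (simp add: left_part_iff)
  show "(Inl a, Inl b) \<notin> \<beta>"
    by (subst eq, auto simp: left_part_def pbr_id_def)
  show "(Inl a, Inr b) \<in> \<beta> \<longleftrightarrow> a = b \<and> a \<in> Y"
    by (subst eq, auto simp: left_part_def pbr_id_def)
  show "(Inr a, Inl b) \<in> \<beta> \<longleftrightarrow> a = b \<and> a \<in> Y"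
    by (subst eq, auto simp: left_part_def pbr_id_def)
qed

lemma right_polarized_edges:
  assumes "right_polarized X \<delta>"
  shows "(Inr a, Inr b) \<notin> \<delta>"
    and "(Inl a, Inr b) \<in> \<delta> \<longleftrightarrow> a = b \<and> a \<in> X"
    and "(Inr a, Inl b) \<in> \<delta> \<longleftrightarrow> a = b \<and> a \<in> X"
proof -
  have eq: "\<delta> = right_part X \<delta>"
    using assms by (simp add: right_part_iff)
  show "(Inr a, Inr b) \<notin> \<delta>"
    by (subst eq, auto simp: right_part_def pbr_id_def)
  show "(Inl a, Inr b) \<in> \<delta> \<longleftrightarrow> a = b \<and> a \<in> X"
    by (subst eq, auto simp: right_part_def pbr_id_def)
  show "(Inr a, Inl b) \<in> \<delta> \<longleftrightarrow> a = b \<and> a \<in> X"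
    by (subst eq, auto simp: right_part_def pbr_id_def)
qed

lemma pure_pbr_edges:
  assumes "pure_pbr X Y \<gamma>"
  shows "(Inl a, Inl b) \<notin> \<gamma>"
    and "(Inr c, Inr d) \<notin> \<gamma>"
    and "(Inl a, Inr c) \<in> \<gamma> \<Longrightarrow> a \<in> X \<and> c \<in> Y"
    and "(Inr c, Inl a) \<in> \<gamma> \<Longrightarrow> a \<in> X \<and> c \<in> Y"
  using assms by (auto simp: pure_pbr_def)

text \<open>
  The edges of \<open>\<beta>\<close> and \<open>\<delta>\<close> between domain and codomain only carry the edges of \<open>\<gamma>\<close> to the outer
  copies of \<open>X\<close> and \<open>Y\<close>, so the three factors do not interact.
\<close>

lemma polarized_product_edges:
  assumes \<beta>: "left_polarized Y \<beta>" and \<gamma>: "pure_pbr X Y \<gamma>" and \<delta>: "right_polarized X \<delta>"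
  shows "(Inl a, Inl b) \<in> \<beta> \<circ>\<^sub>P \<gamma> \<circ>\<^sub>P \<delta> \<longleftrightarrow> (Inl a, Inl b) \<in> \<delta>"
    and "(Inr c, Inr d) \<in> \<beta> \<circ>\<^sub>P \<gamma> \<circ>\<^sub>P \<delta> \<longleftrightarrow> (Inr c, Inr d) \<in> \<beta>"
    and "(Inl a, Inr c) \<in> \<beta> \<circ>\<^sub>P \<gamma> \<circ>\<^sub>P \<delta> \<longleftrightarrow> (Inl a, Inr c) \<in> \<gamma>"
    and "(Inr c, Inl a) \<in> \<beta> \<circ>\<^sub>P \<gamma> \<circ>\<^sub>P \<delta> \<longleftrightarrow> (Inr c, Inl a) \<in> \<gamma>"
proof -
  note inner = pbr_comp_no_return
    [OF right_polarized_edges(1)[OF \<delta>] pure_pbr_edges(1)[OF \<gamma>]]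
  have "(Inr m, Inr n) \<notin> \<gamma> \<circ>\<^sub>P \<delta>" for m n
    by (simp add: inner(2) pure_pbr_edges(2)[OF \<gamma>])
  note outer = pbr_comp_no_return[OF this left_polarized_edges(1)[OF \<beta>]]
  show "(Inl a, Inl b) \<in> \<beta> \<circ>\<^sub>P \<gamma> \<circ>\<^sub>P \<delta> \<longleftrightarrow> (Inl a, Inl b) \<in> \<delta>"
    "(Inr c, Inr d) \<in> \<beta> \<circ>\<^sub>P \<gamma> \<circ>\<^sub>P \<delta> \<longleftrightarrow> (Inr c, Inr d) \<in> \<beta>"
    "(Inl a, Inr c) \<in> \<beta> \<circ>\<^sub>P \<gamma> \<circ>\<^sub>P \<delta> \<longleftrightarrow> (Inl a, Inr c) \<in> \<gamma>"
    "(Inr c, Inl a) \<in> \<beta> \<circ>\<^sub>P \<gamma> \<circ>\<^sub>P \<delta> \<longleftrightarrow> (Inr c, Inl a) \<in> \<gamma>"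
    by (auto simp: outer inner left_polarized_edges[OF \<beta>] right_polarized_edges[OF \<delta>]
        dest: pure_pbr_edges(3,4)[OF \<gamma>])
qed

lemma pbr_eqI:
  fixes \<alpha> \<alpha>' :: "('a, 'b) pbr"
  assumes "\<And>a b. (Inl a, Inl b) \<in> \<alpha> \<longleftrightarrow> (Inl a, Inl b) \<in> \<alpha>'"
    and "\<And>c d. (Inr c, Inr d) \<in> \<alpha> \<longleftrightarrow> (Inr c, Inr d) \<in> \<alpha>'"
    and "\<And>a c. (Inl a, Inr c) \<in> \<alpha> \<longleftrightarrow> (Inl a, Inr c) \<in> \<alpha>'"
    and "\<And>a c. (Inr c, Inl a) \<in> \<alpha> \<longleftrightarrow> (Inr c, Inl a) \<in> \<alpha>'"
  shows "\<alpha> = \<alpha>'"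
proof (rule set_eqI)
  fix e :: "('a + 'b) \<times> ('a + 'b)"
  obtain u v where "e = (u, v)"
    by (cases e)
  then show "e \<in> \<alpha> \<longleftrightarrow> e \<in> \<alpha>'"
    using assms by (cases u; cases v) auto
qed

lemma pure_pbr_pure_part: "\<alpha> \<in> PB X Y \<Longrightarrow> pure_pbr X Y (pure_part X Y \<alpha>)"
  by (auto simp: pure_pbr_def pure_part_def PB_def)

theorem theorem17:
  fixes X :: "'a set" and Y :: "'b set" and \<alpha> :: "('a, 'b) pbr"
  assumes "finite X" and "finite Y" and "\<alpha> \<in> PB X Y"
  shows "left_polarized Y (left_part Y \<alpha>) \<and>
         pure_pbr X Y (pure_part X Y \<alpha>) \<and>
         right_polarized X (right_part X \<alpha>) \<and>
         \<alpha> = left_part Y \<alpha> \<circ>\<^sub>P pure_part X Y \<alpha> \<circ>\<^sub>P right_part X \<alpha> \<and>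
         (\<forall>\<beta> \<gamma> \<delta>. left_polarized Y \<beta> \<and> pure_pbr X Y \<gamma> \<and> right_polarized X \<delta> \<and>
            \<alpha> = \<beta> \<circ>\<^sub>P \<gamma> \<circ>\<^sub>P \<delta> \<longrightarrow>
            \<beta> = left_part Y \<alpha> \<and> \<gamma> = pure_part X Y \<alpha> \<and> \<delta> = right_part X \<alpha>)"
proof -
  have left: "left_polarized Y (left_part Y \<alpha>)"
    using left_part_iff by blast
  have right: "right_polarized X (right_part X \<alpha>)"
    using right_part_iff by blast
  have pure: "pure_pbr X Y (pure_part X Y \<alpha>)"
    using assms(3) by (rule pure_pbr_pure_part)
  have carrier: "u \<in> X <+> Y \<and> v \<in> X <+> Y" if "(u, v) \<in> \<alpha>" for u v
    using that assms(3) by (auto simp: PB_def)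
  have product: "\<alpha> = left_part Y \<alpha> \<circ>\<^sub>P pure_part X Y \<alpha> \<circ>\<^sub>P right_part X \<alpha>"
    by (rule pbr_eqI; unfold polarized_product_edges[OF left pure right])
      (auto simp: left_part_def right_part_def pure_part_def pbr_id_def dest: carrier)
  have unique: "\<beta> = left_part Y \<alpha> \<and> \<gamma> = pure_part X Y \<alpha> \<and> \<delta> = right_part X \<alpha>"
    if \<beta>: "left_polarized Y \<beta>" and \<gamma>: "pure_pbr X Y \<gamma>" and \<delta>: "right_polarized X \<delta>"
      and \<alpha>: "\<alpha> = \<beta> \<circ>\<^sub>P \<gamma> \<circ>\<^sub>P \<delta>" for \<beta> \<gamma> \<delta>
  proof -
    note edges = polarized_product_edges[OF \<beta> \<gamma> \<delta>, folded \<alpha>]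
    have "\<beta> = left_part Y \<alpha>"
      using \<beta> by (simp add: left_part_iff edges(2))
    moreover have "\<delta> = right_part X \<alpha>"
      using \<delta> by (simp add: right_part_iff edges(1))
    moreover have "\<gamma> = pure_part X Y \<alpha>"
      by (rule pbr_eqI)
        (auto simp: pure_part_def edges(3,4) pure_pbr_edges(1,2)[OF \<gamma>]
          dest: pure_pbr_edges(3,4)[OF \<gamma>])
    ultimately show ?thesis
      by blast
  qed
  from left pure right product unique show ?thesis
    by blast
qed

end
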